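(* Let $H$ be a real Hilbert space, $T:H\rightrightarrows H$ maximal monotone with $T^{-1}(0)\neq\emptyset$, $\sigma\in(0,1)$, $z_0\in H$, and let $(z_k)_{k\ge 0}$, $(\tilde z_k)_{k\ge1}$, $(v_k)_{k\ge1}$, $(\varepsilon_k)_{k\ge1}$, $(\lambda_k)_{k\ge1}$, $(t_k)_{k\ge1}$ be sequences generated by the relaxed HPE method (as defined in the context) from $z_0$ with parameter $\sigma$. Let $d_0$ be the distance from $z_0$ to $T^{-1}(0)$, and let $\Lambda_k,\tilde z_k^a,v_k^a,\varepsilon_k^a$ be the associated aggregate stepsizes and ergodic sequences (as defined in the context). Suppose that there are constants $\eta>0$ and $\tau>0$ such that for every $k\ge 1$ $$\lambda_k\|\tilde z_k-z_{k-1}\|\ge \eta,\qquad t_k\ge\tau .$$ Then, for every $k\ge 1$: 1. there exists $i$ with $1\le i\le k$ such that $$\|v_i\|\le \frac{d_0^2}{\eta(1-\sigma)k\tau},\qquad \varepsilon_i\le \frac{\sigma^2}{2\eta}\,\frac{d_0^3}{\big((1-\sigma^2)k\tau\big)^{3/2}};$$ 2. $v_k^a\in T^{[\varepsilon_k^a]}(\tilde z_k^a)$ and $$\|v_k^a\|\le \frac{2d_0^2}{(\tau k)^{3/2}\,\eta\sqrt{1-\sigma^2}},\qquad \varepsilon_k^a\le\frac{2d_0^3}{(\tau k)^{3/2}\,\eta(1-\sigma^2)} .$$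
   Context: A point-to-set operator $T:H\rightrightarrows H$ is a relation $T\subset H\times H$, with $T(z)=\{v : (z,v)\in T\}$ and $T^{-1}(0)=\{z : 0\in T(z)\}$. It is monotone if $\langle z-z',v-v'\rangle\ge0$ for all $(z,v),(z',v')\in T$, and maximal monotone if it is maximal, with respect to inclusion, among monotone operators. For $\varepsilon\ge0$ the $\varepsilon$-enlargement of $T$ is $T^{[\varepsilon]}(z)=\{v : \langle z-z',v-v'\rangle\ge-\varepsilon\ \ \forall (z',v')\in T\}$, $z\in H$. Relaxed HPE (r-HPE) method: given $z_0\in H$ and $\sigma\in(0,1)$, for each $k=1,2,\dots$ one has $\tilde z_k,v_k\in H$, $\varepsilon_k\ge0$, $\lambda_k>0$ such that $$v_k\in T^{[\varepsilon_k]}(\tilde z_k),\qquad \|\lambda_kv_k+\tilde z_k-z_{k-1}\|^2+2\lambda_k\varepsilon_k\le\sigma^2\|\tilde z_k-z_{k-1}\|^2,$$ and $t_k\in(0,1]$, and $z_k=z_{k-1}-t_k\lambda_kv_k$. Aggregate stepsize and ergodic sequences: $$\Lambda_k=\sum_{i=1}^k t_i\lambda_i,\quad \tilde z_k^a=\frac1{\Lambda_k}\sum_{i=1}^k t_i\lambda_i\tilde z_i,\quad v_k^a=\frac1{\Lambda_k}\sum_{i=1}^k t_i\lambda_iv_i,\quad \varepsilon_k^a=\frac1{\Lambda_k}\sum_{i=1}^k t_i\lambda_i\big(\varepsilon_i+\langle\tilde z_i-\tilde z_k^a,\,v_i-v_k^a\rangle\big).$$ *)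

theory Defs
  imports "HOL-Analysis.Analysis"
begin

text \<open>A point-to-set operator on \<open>H\<close> is identified with its graph, a set of pairs.\<close>

type_synonym 'a operator = "('a \<times> 'a) set"

definition zeros :: "'a::real_inner operator \<Rightarrow> 'a set" where
  "zeros T = {z. (z, 0) \<in> T}"

definition monotone_operator :: "'a::real_inner operator \<Rightarrow> bool" where
  "monotone_operator T \<longleftrightarrow>
     (\<forall>(z, v)\<in>T. \<forall>(z', v')\<in>T. 0 \<le> inner (z - z') (v - v'))"

definition maximal_monotone :: "'a::real_inner operator \<Rightarrow> bool" where
  "maximal_monotone T \<longleftrightarrow>
     monotone_operator T \<and> (\<forall>S. monotone_operator S \<longrightarrow> T \<subseteq> S \<longrightarrow> S = T)"

text \<open>Meant for \<open>\<epsilon> \<ge> 0\<close>; for maximal monotone \<open>T\<close> and \<open>\<epsilon> < 0\<close> the set below is empty.\<close>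

definition enlargement :: "'a::real_inner operator \<Rightarrow> real \<Rightarrow> 'a \<Rightarrow> 'a set" where
  "enlargement T \<epsilon> z = {v. \<forall>(z', v')\<in>T. - \<epsilon> \<le> inner (z - z') (v - v')}"

text \<open>Only \<open>z\<close> is used at index \<open>0\<close>; all other sequences start at index \<open>1\<close>,
  and their values at \<open>0\<close> are irrelevant.\<close>

definition relaxed_HPE ::
  "'a::real_inner operator \<Rightarrow> real \<Rightarrow> 'a \<Rightarrow> (nat \<Rightarrow> 'a) \<Rightarrow> (nat \<Rightarrow> 'a) \<Rightarrow> (nat \<Rightarrow> 'a) \<Rightarrow>
   (nat \<Rightarrow> real) \<Rightarrow> (nat \<Rightarrow> real) \<Rightarrow> (nat \<Rightarrow> real) \<Rightarrow> bool" where
  "relaxed_HPE T \<sigma> z0 z zt v \<epsilon> lam t \<longleftrightarrow>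
     z 0 = z0 \<and>
     (\<forall>k\<ge>1.
        0 \<le> \<epsilon> k \<and> 0 < lam k \<and>
        v k \<in> enlargement T (\<epsilon> k) (zt k) \<and>
        (norm (lam k *\<^sub>R v k + zt k - z (k - 1)))\<^sup>2 + 2 * lam k * \<epsilon> k
          \<le> \<sigma>\<^sup>2 * (norm (zt k - z (k - 1)))\<^sup>2 \<and>
        0 < t k \<and> t k \<le> 1 \<and>
        z k = z (k - 1) - (t k * lam k) *\<^sub>R v k)"

definition aggregate_stepsize :: "(nat \<Rightarrow> real) \<Rightarrow> (nat \<Rightarrow> real) \<Rightarrow> nat \<Rightarrow> real" where
  "aggregate_stepsize t lam k = (\<Sum>i=1..k. t i * lam i)"

definition ergodic_mean ::
  "(nat \<Rightarrow> real) \<Rightarrow> (nat \<Rightarrow> real) \<Rightarrow> (nat \<Rightarrow> 'a::real_vector) \<Rightarrow> nat \<Rightarrow> 'a" where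
  "ergodic_mean t lam x k =
     (1 / aggregate_stepsize t lam k) *\<^sub>R (\<Sum>i=1..k. (t i * lam i) *\<^sub>R x i)"

definition ergodic_error ::
  "(nat \<Rightarrow> real) \<Rightarrow> (nat \<Rightarrow> real) \<Rightarrow> (nat \<Rightarrow> 'a::real_inner) \<Rightarrow> (nat \<Rightarrow> 'a) \<Rightarrow>
   (nat \<Rightarrow> real) \<Rightarrow> nat \<Rightarrow> real" where
  "ergodic_error t lam zt v \<epsilon> k =
     (1 / aggregate_stepsize t lam k) *
     (\<Sum>i=1..k. t i * lam i *
        (\<epsilon> i + inner (zt i - ergodic_mean t lam zt k) (v i - ergodic_mean t lam v k)))"

end

theory Submission
  imports Defs
begin

text \<open>
  One relaxed step decreases the squared distance to \<^emph>\<open>every\<close> point \<open>p\<close> up to an error: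
  with \<open>r\<^sub>k = \<parallel>zt\<^sub>k - z\<^sub>k\<^sub>-\<^sub>1\<parallel>\<close>,
  \<open>\<parallel>z\<^sub>k - p\<parallel>\<^sup>2 + t\<^sub>k (1 - \<sigma>\<^sup>2) r\<^sub>k\<^sup>2 + 2 t\<^sub>k \<lambda>\<^sub>k (\<epsilon>\<^sub>k + \<langle>zt\<^sub>k - p, v\<^sub>k\<rangle>) \<le> \<parallel>z\<^sub>k\<^sub>-\<^sub>1 - p\<parallel>\<^sup>2\<close>,
  and this is summed over the steps (\<open>telescoped_decrease\<close>). The sum is used for two kinds of \<open>p\<close>.

  If \<open>p\<close> is a zero of \<open>T\<close>, the definition of the enlargement makes the last summand nonnegative.
  Hence the iterates never move away from \<open>p\<close>, so that \<open>\<parallel>z\<^sub>k - z\<^sub>0\<parallel> \<le> 2 d\<^sub>0\<close>, and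
  \<open>\<Sum> t\<^sub>i r\<^sub>i\<^sup>2 \<le> d\<^sub>0\<^sup>2 / (1 - \<sigma>\<^sup>2)\<close>. The pointwise bounds follow at the index \<open>i\<close> where \<open>r\<^sub>i\<close> is least,
  because the large-step condition \<open>\<lambda>\<^sub>i r\<^sub>i \<ge> \<eta>\<close> turns \<open>1 / \<lambda>\<^sub>i\<close> into at most \<open>r\<^sub>i / \<eta>\<close>.

  For the ergodic bounds, the large-step condition gives \<open>\<Lambda>\<^sub>k \<ge> \<eta> \<Sum> t\<^sub>i / r\<^sub>i\<close>, and a weighted
  power-mean inequality against \<open>\<Sum> t\<^sub>i r\<^sub>i\<^sup>2\<close> makes \<open>\<Lambda>\<^sub>k\<close> grow like \<open>(\<tau> k)\<^bsup>3/2\<^esup>\<close>. Since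
  \<open>\<Lambda>\<^sub>k v\<^sub>k\<^sup>a = z\<^sub>0 - z\<^sub>k\<close>, the bound on \<open>v\<^sub>k\<^sup>a\<close> follows. The bound on \<open>\<epsilon>\<^sub>k\<^sup>a\<close> uses the summed inequality
  with \<open>p = zt\<^sub>k\<^sup>a\<close>, for which the error terms add up to exactly \<open>2 \<Lambda>\<^sub>k \<epsilon>\<^sub>k\<^sup>a\<close>; it remains to know that
  \<open>zt\<^sub>k\<^sup>a\<close> is not far from the zeros, and each \<open>zt\<^sub>i\<close> is within \<open>\<parallel>z\<^sub>0 - p\<parallel> / sqrt (1 - \<sigma>\<^sup>2)\<close> of a zero \<open>p\<close>.
  These estimates hold with \<open>\<parallel>z\<^sub>0 - p\<parallel>\<close> for every zero \<open>p\<close>, and \<open>d\<^sub>0\<close> enters by taking the infimum over \<open>p\<close>.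
\<close>

section \<open>Inequalities on real numbers, means and distances\<close>

text \<open>Taking square roots turns the hypothesis into a lower bound for all distances, hence for their
  infimum. In this form the estimates relative to single zeros become estimates in the distance to
  the set of zeros.\<close>

lemma le_infdist_square:
  fixes A :: "'b::metric_space set"
  assumes "A \<noteq> {}" and "0 < c" and bound: "\<And>p. p \<in> A \<Longrightarrow> x \<le> c * (dist z p)\<^sup>2"
  shows "x \<le> c * (infdist z A)\<^sup>2"
proof (cases "x \<le> 0")
  case True
  then show ?thesis
    using \<open>0 < c\<close> by (smt (verit) mult_nonneg_nonneg zero_le_power2)
next
  case False
  have "sqrt (x / c) \<le> dist z p" if "p \<in> A" for p
    using bound[OF that] \<open>0 < c\<close> by (intro real_le_lsqrt) (auto simp: field_simps)
  then have "sqrt (x / c) \<le> infdist z A"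
    using \<open>A \<noteq> {}\<close> by (auto simp: infdist_def intro!: cINF_greatest)
  moreover have "0 \<le> x / c"
    using False \<open>0 < c\<close> by simp
  ultimately have "x / c \<le> (infdist z A)\<^sup>2"
    by (simp add: sqrt_le_D)
  then show ?thesis
    using \<open>0 < c\<close> by (simp add: field_simps)
qed

lemma sqrt_cubed_eq_powr:
  fixes x :: real
  assumes "0 < x"
  shows "sqrt x ^ 3 = x powr (3 / 2)"
proof -
  have "sqrt x ^ 3 = (x powr (1 / 2)) powr real 3"
    using assms by (subst powr_realpow) (auto simp: powr_half_sqrt)
  then show ?thesis
    by (simp add: powr_powr)
qed

text \<open>The right-hand side is the tangent at \<open>s\<^sup>2\<close> of the convex function \<open>x\<^bsup>-1/2\<^esup>\<close>, evaluated at
  \<open>x = r\<^sup>2\<close>; clearing denominators leaves \<open>(s - r)\<^sup>2 (2 s + r) \<ge> 0\<close>.\<close>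

lemma inverse_ge_tangent_in_square:
  fixes r s :: real
  assumes "0 < r" and "0 < s"
  shows "3 / (2 * s) - r\<^sup>2 / (2 * s ^ 3) \<le> 1 / r"
proof -
  have "0 \<le> (s - r)\<^sup>2 * (2 * s + r)"
    using assms by simp
  then have "3 * s\<^sup>2 * r - r ^ 3 \<le> 2 * s ^ 3"
    by (simp add: power2_eq_square power3_eq_cube algebra_simps)
  moreover have "3 / (2 * s) - r\<^sup>2 / (2 * s ^ 3) = (3 * s\<^sup>2 * r - r ^ 3) / (2 * s ^ 3 * r)"
    using assms by (simp add: field_simps power2_eq_square power3_eq_cube)
  moreover have "1 / r = 2 * s ^ 3 / (2 * s ^ 3 * r)"
    using assms by simp
  ultimately show ?thesis
    using assms by (simp only:) (intro divide_right_mono, auto)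
qed

text \<open>The weighted power-mean inequality between the exponents \<open>-1\<close> and \<open>2\<close>. The tangent inequality is
  summed with contact point \<open>s = sqrt (D / S)\<close>, which is the quadratic mean of the \<open>r i\<close> when both
  assumed bounds are equalities.\<close>

lemma sum_inverse_ge_power_mean:
  fixes w r :: "'i \<Rightarrow> real"
  assumes "\<And>i. i \<in> I \<Longrightarrow> 0 \<le> w i" and "\<And>i. i \<in> I \<Longrightarrow> 0 < r i"
    and "0 < S" and S: "S \<le> (\<Sum>i\<in>I. w i)"
    and "0 < D" and D: "(\<Sum>i\<in>I. w i * (r i)\<^sup>2) \<le> D"
  shows "sqrt S ^ 3 / sqrt D \<le> (\<Sum>i\<in>I. w i / r i)"
proof -
  define s where "s = sqrt D / sqrt S"
  have "0 < s"
    using assms by (simp add: s_def)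
  have sq: "s\<^sup>2 = D / S"
    using assms by (simp add: s_def power_divide)
  have "sqrt S ^ 3 / sqrt D = S / s"
    using \<open>0 < S\<close> \<open>0 < D\<close> by (simp add: s_def power3_eq_cube)
  also have "\<dots> = 3 / (2 * s) * S - D / (2 * s ^ 3)"
  proof -
    have "D = s\<^sup>2 * S"
      using sq \<open>0 < S\<close> by simp
    then show ?thesis
      using \<open>0 < s\<close> by (simp add: field_simps power2_eq_square power3_eq_cube)
  qed
  also have "\<dots> \<le> 3 / (2 * s) * (\<Sum>i\<in>I. w i) - (\<Sum>i\<in>I. w i * (r i)\<^sup>2) / (2 * s ^ 3)"
    using S D \<open>0 < s\<close> by (intro diff_mono mult_left_mono divide_right_mono) auto
  also have "\<dots> = (\<Sum>i\<in>I. w i * (3 / (2 * s) - (r i)\<^sup>2 / (2 * s ^ 3)))"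
    by (simp only: right_diff_distrib sum_subtractf sum_distrib_left sum_divide_distrib times_divide_eq_right)
      (simp add: mult.commute)
  also have "\<dots> \<le> (\<Sum>i\<in>I. w i * (1 / r i))"
    using assms(1,2) \<open>0 < s\<close>
    by (intro sum_mono mult_left_mono inverse_ge_tangent_in_square) auto
  finally show ?thesis
    by simp
qed

text \<open>The parallel-axis identity for a weighted covariance. With \<open>a\<close>, \<open>b\<close> a point of the graph of an
  operator it moves enlargement inequalities to the means; with \<open>b = 0\<close> it simplifies the ergodic
  error.\<close>

lemma weighted_covariance_shift:
  fixes x y :: "'i \<Rightarrow> 'b::real_inner"
  assumes W: "W = (\<Sum>i\<in>I. w i)"
    and x: "W *\<^sub>R mx = (\<Sum>i\<in>I. w i *\<^sub>R x i)" and y: "W *\<^sub>R my = (\<Sum>i\<in>I. w i *\<^sub>R y i)"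
  shows "(\<Sum>i\<in>I. w i * inner (x i - a) (y i - b))
    = (\<Sum>i\<in>I. w i * inner (x i - mx) (y i - my)) + W * inner (mx - a) (my - b)"
proof -
  have expand: "(\<Sum>i\<in>I. w i * inner (x i - c) (y i - d))
    = (\<Sum>i\<in>I. w i * inner (x i) (y i)) - W * inner mx d - W * inner c my + W * inner c d" for c d
  proof -
    have "(\<Sum>i\<in>I. w i * inner (x i - c) (y i - d))
      = (\<Sum>i\<in>I. w i * inner (x i) (y i) - inner (w i *\<^sub>R x i) d - inner c (w i *\<^sub>R y i)
          + w i * inner c d)"
      by (intro sum.cong) (auto simp: inner_diff_left inner_diff_right algebra_simps)
    also have "\<dots> = (\<Sum>i\<in>I. w i * inner (x i) (y i)) - inner (\<Sum>i\<in>I. w i *\<^sub>R x i) d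
        - inner c (\<Sum>i\<in>I. w i *\<^sub>R y i) + (\<Sum>i\<in>I. w i) * inner c d"
      by (simp only: sum.distrib sum_subtractf inner_sum_left inner_sum_right sum_distrib_right)
    finally show ?thesis
      by (simp add: x[symmetric] y[symmetric] W[symmetric])
  qed
  show ?thesis
    unfolding expand by (simp add: inner_diff_left inner_diff_right algebra_simps)
qed

section \<open>A single relaxed step\<close>

text \<open>Expanding the square in the error criterion gives
  \<open>2 l \<langle>v, x - y\<rangle> \<ge> \<parallel>l v\<parallel>\<^sup>2 + (1 - \<sigma>\<^sup>2) \<parallel>y - x\<parallel>\<^sup>2 + 2 l e\<close>. The term \<open>\<parallel>l v\<parallel>\<^sup>2\<close>, weighted by \<open>t\<close>, dominates the
  quadratic term \<open>t\<^sup>2 \<parallel>l v\<parallel>\<^sup>2\<close> of the step, as \<open>t \<le> 1\<close>.\<close>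

lemma relaxed_step_decrease:
  fixes x y v p :: "'b::real_inner"
  assumes crit: "(norm (l *\<^sub>R v + y - x))\<^sup>2 + 2 * l * e \<le> \<sigma>\<^sup>2 * (norm (y - x))\<^sup>2"
    and "0 \<le> t" and "t \<le> 1"
  shows "(norm (x - (t * l) *\<^sub>R v - p))\<^sup>2 + t * ((1 - \<sigma>\<^sup>2) * (norm (y - x))\<^sup>2)
    + 2 * (t * l) * (e + inner (y - p) v) \<le> (norm (x - p))\<^sup>2"
proof -
  have step: "(norm (x - (t * l) *\<^sub>R v - p))\<^sup>2
    = (norm (x - p))\<^sup>2 - 2 * (t * l) * inner (x - p) v + t\<^sup>2 * (l\<^sup>2 * (norm v)\<^sup>2)"
    unfolding power2_norm_eq_inner
    by (simp add: inner_diff_left inner_diff_right inner_commute power2_eq_square algebra_simps)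
  have "(norm (l *\<^sub>R v + y - x))\<^sup>2
    = l\<^sup>2 * (norm v)\<^sup>2 + 2 * l * inner (y - x) v + (norm (y - x))\<^sup>2"
    unfolding power2_norm_eq_inner
    by (simp add: inner_diff_left inner_diff_right inner_add_left inner_add_right inner_commute
        power2_eq_square algebra_simps)
  with crit have "0 \<le> \<sigma>\<^sup>2 * (norm (y - x))\<^sup>2 - (norm (y - x))\<^sup>2 - 2 * l * inner (y - x) v
      - l\<^sup>2 * (norm v)\<^sup>2 - 2 * l * e"
    by simp
  then have "0 \<le> t * (\<sigma>\<^sup>2 * (norm (y - x))\<^sup>2 - (norm (y - x))\<^sup>2 - 2 * l * inner (y - x) v
      - l\<^sup>2 * (norm v)\<^sup>2 - 2 * l * e)"
    using \<open>0 \<le> t\<close> by (rule mult_nonneg_nonneg[rotated])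
  moreover have "t\<^sup>2 * (l\<^sup>2 * (norm v)\<^sup>2) \<le> t * (l\<^sup>2 * (norm v)\<^sup>2)"
    using \<open>0 \<le> t\<close> \<open>t \<le> 1\<close>
    by (intro mult_right_mono) (auto simp: power2_eq_square mult_left_le)
  moreover have "inner (x - p) v = inner (y - p) v - inner (y - x) v"
    by (simp add: inner_diff_left)
  ultimately show ?thesis
    unfolding step by (simp add: algebra_simps)
qed

text \<open>The full step \<open>x - l v\<close> satisfies \<open>\<parallel>x - l v - p\<parallel>\<^sup>2 + (1 - \<sigma>\<^sup>2) r\<^sup>2 \<le> \<parallel>x - p\<parallel>\<^sup>2\<close> with \<open>r = \<parallel>y - x\<parallel>\<close>, and
  \<open>y\<close> is within \<open>\<sigma> r\<close> of it. The Cauchy-Schwarz inequality then bounds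
  \<open>\<parallel>x - l v - p\<parallel> + \<sigma> r\<close>.\<close>

lemma extragradient_point_near_zero:
  fixes x y v p :: "'b::real_inner"
  assumes crit: "(norm (l *\<^sub>R v + y - x))\<^sup>2 + 2 * l * e \<le> \<sigma>\<^sup>2 * (norm (y - x))\<^sup>2"
    and "0 \<le> \<sigma>" and "\<sigma> < 1" and "0 \<le> l" and "0 \<le> e" and pos: "0 \<le> e + inner (y - p) v"
  shows "norm (y - p) \<le> norm (x - p) / sqrt (1 - \<sigma>\<^sup>2)"
proof -
  define r where "r = norm (y - x)"
  define a where "a = norm (x - l *\<^sub>R v - p)"
  have "0 < 1 - \<sigma>\<^sup>2"
    using assms by (simp add: power_less_one_iff abs_square_less_1)
  have "0 \<le> 2 * l * (e + inner (y - p) v)"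
    using assms by simp
  then have full: "a\<^sup>2 + (1 - \<sigma>\<^sup>2) * r\<^sup>2 \<le> (norm (x - p))\<^sup>2"
    using relaxed_step_decrease[OF crit, of 1 p] by (simp add: a_def r_def)
  have "0 \<le> 2 * l * e"
    using assms by simp
  then have "(norm (l *\<^sub>R v + y - x))\<^sup>2 \<le> (\<sigma> * r)\<^sup>2"
    using crit unfolding r_def power_mult_distrib by linarith
  then have "norm (l *\<^sub>R v + y - x) \<le> \<sigma> * r"
    using \<open>0 \<le> \<sigma>\<close> by (simp add: r_def power2_le_iff_abs_le)
  moreover have "norm (y - p) \<le> a + norm (l *\<^sub>R v + y - x)"
    using norm_triangle_ineq[of "x - l *\<^sub>R v - p" "l *\<^sub>R v + y - x"] by (simp add: a_def)
  ultimately have "norm (y - p) \<le> a + \<sigma> * r"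
    by simp
  then have "(norm (y - p))\<^sup>2 * (1 - \<sigma>\<^sup>2) \<le> (a + \<sigma> * r)\<^sup>2 * (1 - \<sigma>\<^sup>2)"
    using \<open>0 < 1 - \<sigma>\<^sup>2\<close> by (intro mult_right_mono power_mono) auto
  also have "\<dots> = a\<^sup>2 + (1 - \<sigma>\<^sup>2) * r\<^sup>2 - (\<sigma> * a - (1 - \<sigma>\<^sup>2) * r)\<^sup>2"
    by (simp add: power2_eq_square algebra_simps)
  also have "\<dots> \<le> (norm (x - p))\<^sup>2"
    using full by (smt (verit) zero_le_power2)
  finally have "(norm (y - p) * sqrt (1 - \<sigma>\<^sup>2))\<^sup>2 \<le> (norm (x - p))\<^sup>2"
    using \<open>0 < 1 - \<sigma>\<^sup>2\<close> by (simp add: power_mult_distrib)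
  then have "norm (y - p) * sqrt (1 - \<sigma>\<^sup>2) \<le> norm (x - p)"
    by (rule power2_le_imp_le) simp
  then show ?thesis
    using \<open>0 < 1 - \<sigma>\<^sup>2\<close> by (simp add: pos_le_divide_eq)
qed

section \<open>Runs of the relaxed method\<close>

locale relaxed_HPE_run =
  fixes T :: "'a::real_inner operator" and \<sigma> :: real and z0 :: 'a
    and z zt v :: "nat \<Rightarrow> 'a" and \<epsilon> lam t :: "nat \<Rightarrow> real"
  assumes run: "relaxed_HPE T \<sigma> z0 z zt v \<epsilon> lam t"
    and sigma_pos: "0 < \<sigma>" and sigma_less_1: "\<sigma> < 1"
begin

abbreviation "r k \<equiv> norm (zt k - z (k - 1))"

abbreviation "\<Lambda> \<equiv> aggregate_stepsize t lam"

lemma z_0: "z 0 = z0"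
  using run by (simp add: relaxed_HPE_def)

lemma
  assumes "1 \<le> k"
  shows eps_nonneg: "0 \<le> \<epsilon> k" and lam_pos: "0 < lam k"
    and v_enlargement: "v k \<in> enlargement T (\<epsilon> k) (zt k)"
    and criterion: "(norm (lam k *\<^sub>R v k + zt k - z (k - 1)))\<^sup>2 + 2 * lam k * \<epsilon> k \<le> \<sigma>\<^sup>2 * (r k)\<^sup>2"
    and t_pos: "0 < t k" and t_le_1: "t k \<le> 1"
    and z_step: "z k = z (k - 1) - (t k * lam k) *\<^sub>R v k"
  using run assms by (auto simp: relaxed_HPE_def)

lemma one_minus_sigma2_pos: "0 < 1 - \<sigma>\<^sup>2"
  using sigma_pos sigma_less_1 by (simp add: power_less_one_iff abs_square_less_1)

lemma telescoped_decrease: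
  "(norm (z k - p))\<^sup>2 + (1 - \<sigma>\<^sup>2) * (\<Sum>i=1..k. t i * (r i)\<^sup>2)
    + 2 * (\<Sum>i=1..k. t i * lam i * (\<epsilon> i + inner (zt i - p) (v i))) \<le> (norm (z0 - p))\<^sup>2"
proof (induction k)
  case 0
  then show ?case
    by (simp add: z_0)
next
  case (Suc k)
  have "(norm (z (Suc k) - p))\<^sup>2 + t (Suc k) * ((1 - \<sigma>\<^sup>2) * (r (Suc k))\<^sup>2)
    + 2 * (t (Suc k) * lam (Suc k)) * (\<epsilon> (Suc k) + inner (zt (Suc k) - p) (v (Suc k)))
    \<le> (norm (z k - p))\<^sup>2"
    using relaxed_step_decrease[OF criterion, of "Suc k" "t (Suc k)" p]
      t_pos[of "Suc k"] t_le_1[of "Suc k"] z_step[of "Suc k"] by simp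
  with Suc.IH show ?case
    by (simp add: algebra_simps)
qed

lemma enlargement_at_zero:
  assumes "p \<in> zeros T" and "1 \<le> i"
  shows "0 \<le> \<epsilon> i + inner (zt i - p) (v i)"
proof -
  have "- \<epsilon> i \<le> inner (zt i - p) (v i - 0)"
    using v_enlargement[OF assms(2)] assms(1) unfolding enlargement_def zeros_def by blast
  then show ?thesis
    by simp
qed

lemma
  assumes "p \<in> zeros T"
  shows fejer: "norm (z k - p) \<le> norm (z0 - p)"
    and sum_residuals_le: "(1 - \<sigma>\<^sup>2) * (\<Sum>i=1..k. t i * (r i)\<^sup>2) \<le> (norm (z0 - p))\<^sup>2"
proof -
  have "0 \<le> (\<Sum>i=1..k. t i * lam i * (\<epsilon> i + inner (zt i - p) (v i)))"
    using enlargement_at_zero[OF assms] t_pos lam_pos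
    by (intro sum_nonneg mult_nonneg_nonneg) (auto intro: less_imp_le)
  then have decr: "(norm (z k - p))\<^sup>2 + (1 - \<sigma>\<^sup>2) * (\<Sum>i=1..k. t i * (r i)\<^sup>2) \<le> (norm (z0 - p))\<^sup>2"
    using telescoped_decrease[of k p] by simp
  moreover have "0 \<le> (1 - \<sigma>\<^sup>2) * (\<Sum>i=1..k. t i * (r i)\<^sup>2)"
    using one_minus_sigma2_pos t_pos
    by (intro mult_nonneg_nonneg sum_nonneg) (auto intro: less_imp_le)
  ultimately have "(norm (z k - p))\<^sup>2 \<le> (norm (z0 - p))\<^sup>2"
    by linarith
  then show "norm (z k - p) \<le> norm (z0 - p)"
    by (rule power2_le_imp_le) simp
  show "(1 - \<sigma>\<^sup>2) * (\<Sum>i=1..k. t i * (r i)\<^sup>2) \<le> (norm (z0 - p))\<^sup>2"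
    using decr by (smt (verit) zero_le_power2)
qed

lemma zt_near_zero:
  assumes "p \<in> zeros T" and "1 \<le> i"
  shows "norm (zt i - p) \<le> norm (z0 - p) / sqrt (1 - \<sigma>\<^sup>2)"
proof -
  have "norm (zt i - p) \<le> norm (z (i - 1) - p) / sqrt (1 - \<sigma>\<^sup>2)"
    using extragradient_point_near_zero[OF criterion] assms enlargement_at_zero
      sigma_pos sigma_less_1 eps_nonneg lam_pos by (simp add: less_imp_le)
  also have "\<dots> \<le> norm (z0 - p) / sqrt (1 - \<sigma>\<^sup>2)"
    using fejer[OF assms(1)] one_minus_sigma2_pos by (intro divide_right_mono) auto
  finally show ?thesis .
qed

text \<open>The criterion bounds \<open>\<parallel>\<lambda> v\<parallel>\<close> by \<open>(1 + \<sigma>) r\<close> and \<open>2 \<lambda> \<epsilon>\<close> by \<open>\<sigma>\<^sup>2 r\<^sup>2\<close>; the large-step condition then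
  replaces division by \<open>\<lambda>\<close> by multiplication by \<open>r / \<eta>\<close>.\<close>

lemma
  assumes "1 \<le> i" and "0 < \<eta>" and large: "\<eta> \<le> lam i * r i"
  shows norm_v_le_residual: "norm (v i) \<le> (1 + \<sigma>) * (r i)\<^sup>2 / \<eta>"
    and eps_le_residual: "\<epsilon> i \<le> \<sigma>\<^sup>2 / (2 * \<eta>) * r i ^ 3"
proof -
  note lam = lam_pos[OF assms(1)] and eps = eps_nonneg[OF assms(1)] and crit = criterion[OF assms(1)]
  have "0 \<le> 2 * lam i * \<epsilon> i"
    using lam eps by simp
  then have "(norm (lam i *\<^sub>R v i + zt i - z (i - 1)))\<^sup>2 \<le> (\<sigma> * r i)\<^sup>2"
    using crit unfolding power_mult_distrib by linarith
  then have "norm (lam i *\<^sub>R v i + zt i - z (i - 1)) \<le> \<sigma> * r i"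
    by (rule power2_le_imp_le) (simp add: sigma_pos less_imp_le)
  moreover have "norm (lam i *\<^sub>R v i)
      \<le> norm (lam i *\<^sub>R v i + zt i - z (i - 1)) + r i"
    using norm_triangle_ineq4[of "lam i *\<^sub>R v i + zt i - z (i - 1)" "zt i - z (i - 1)"] by simp
  ultimately have "lam i * norm (v i) \<le> (1 + \<sigma>) * r i"
    using lam by (simp add: algebra_simps)
  then have "r i * (lam i * norm (v i)) \<le> r i * ((1 + \<sigma>) * r i)"
    by (rule mult_left_mono) simp
  moreover have "\<eta> * norm (v i) \<le> (lam i * r i) * norm (v i)"
    using large by (rule mult_right_mono) simp
  ultimately have "\<eta> * norm (v i) \<le> (1 + \<sigma>) * (r i)\<^sup>2"
    by (simp add: power2_eq_square mult_ac)
  then show "norm (v i) \<le> (1 + \<sigma>) * (r i)\<^sup>2 / \<eta>"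
    using \<open>0 < \<eta>\<close> by (simp add: field_simps)
  have "2 * lam i * \<epsilon> i \<le> \<sigma>\<^sup>2 * (r i)\<^sup>2"
    using crit by (smt (verit) zero_le_power2)
  then have "r i * (2 * lam i * \<epsilon> i) \<le> r i * (\<sigma>\<^sup>2 * (r i)\<^sup>2)"
    by (rule mult_left_mono) simp
  moreover have "\<eta> * \<epsilon> i \<le> (lam i * r i) * \<epsilon> i"
    using large eps by (rule mult_right_mono)
  ultimately have "2 * (\<eta> * \<epsilon> i) \<le> \<sigma>\<^sup>2 * r i ^ 3"
    by (simp add: power2_eq_square power3_eq_cube mult_ac)
  then show "\<epsilon> i \<le> \<sigma>\<^sup>2 / (2 * \<eta>) * r i ^ 3"
    using \<open>0 < \<eta>\<close> by (simp add: field_simps)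
qed

section \<open>Ergodic sequences\<close>

lemma aggregate_stepsize_pos:
  assumes "1 \<le> k"
  shows "0 < \<Lambda> k"
  unfolding aggregate_stepsize_def using assms t_pos lam_pos by (intro sum_pos) auto

lemma aggregate_scaleR_mean:
  assumes "1 \<le> k"
  shows "\<Lambda> k *\<^sub>R ergodic_mean t lam x k = (\<Sum>i=1..k. (t i * lam i) *\<^sub>R x i)"
  using aggregate_stepsize_pos[OF assms] by (simp add: ergodic_mean_def)

lemma aggregate_mult_error:
  assumes "1 \<le> k"
  shows "\<Lambda> k * ergodic_error t lam zt v \<epsilon> k = (\<Sum>i=1..k. t i * lam i * \<epsilon> i)
    + (\<Sum>i=1..k. t i * lam i
        * inner (zt i - ergodic_mean t lam zt k) (v i - ergodic_mean t lam v k))"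
  using aggregate_stepsize_pos[OF assms]
  by (simp add: ergodic_error_def distrib_left sum.distrib mult.assoc)

lemma ergodic_covariance_shift:
  assumes "1 \<le> k"
  shows "(\<Sum>i=1..k. t i * lam i * (\<epsilon> i + inner (zt i - a) (v i - b)))
    = \<Lambda> k * (ergodic_error t lam zt v \<epsilon> k
        + inner (ergodic_mean t lam zt k - a) (ergodic_mean t lam v k - b))"
  using weighted_covariance_shift[OF aggregate_stepsize_def
      aggregate_scaleR_mean[OF assms, of zt] aggregate_scaleR_mean[OF assms, of v], of a b]
  by (simp add: distrib_left sum.distrib aggregate_mult_error[OF assms])

lemma ergodic_mean_in_enlargement:
  assumes "1 \<le> k"
  shows "ergodic_mean t lam v k
    \<in> enlargement T (ergodic_error t lam zt v \<epsilon> k) (ergodic_mean t lam zt k)"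
proof -
  have "- ergodic_error t lam zt v \<epsilon> k
      \<le> inner (ergodic_mean t lam zt k - a) (ergodic_mean t lam v k - b)"
    if "(a, b) \<in> T" for a b
  proof -
    have "0 \<le> \<epsilon> i + inner (zt i - a) (v i - b)" if "1 \<le> i" for i
      using v_enlargement[OF that] \<open>(a, b) \<in> T\<close> by (fastforce simp: enlargement_def)
    then have "0 \<le> (\<Sum>i=1..k. t i * lam i * (\<epsilon> i + inner (zt i - a) (v i - b)))"
      using t_pos lam_pos by (intro sum_nonneg mult_nonneg_nonneg) (auto intro: less_imp_le)
    then show ?thesis
      unfolding ergodic_covariance_shift[OF assms]
      using aggregate_stepsize_pos[OF assms] by (simp add: zero_le_mult_iff)
  qed
  then show ?thesis
    by (auto simp: enlargement_def)
qed

lemma aggregate_scaleR_mean_v: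
  assumes "1 \<le> k"
  shows "\<Lambda> k *\<^sub>R ergodic_mean t lam v k = z0 - z k"
proof -
  have "(\<Sum>i=1..k. (t i * lam i) *\<^sub>R v i) = z0 - z k"
  proof (induction k)
    case 0
    then show ?case
      by (simp add: z_0)
  next
    case (Suc k)
    then show ?case
      using z_step[of "Suc k"] by simp
  qed
  then show ?thesis
    by (simp add: aggregate_scaleR_mean[OF assms])
qed

lemma aggregate_mult_norm_mean_v_le:
  assumes "p \<in> zeros T" and "1 \<le> k"
  shows "\<Lambda> k * norm (ergodic_mean t lam v k) \<le> 2 * norm (z0 - p)"
proof -
  have "\<Lambda> k * norm (ergodic_mean t lam v k) = norm (z0 - z k)"
    using aggregate_scaleR_mean_v[OF assms(2)] aggregate_stepsize_pos[OF assms(2)]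
    by (metis abs_of_pos norm_scaleR)
  also have "\<dots> \<le> norm (z0 - p) + norm (z k - p)"
    using norm_triangle_ineq4[of "z0 - p" "z k - p"] by simp
  finally show ?thesis
    using fejer[OF assms(1), of k] by simp
qed

text \<open>The mean is a convex combination of points of a ball around \<open>p\<close>.\<close>

lemma mean_zt_near_zero:
  assumes "p \<in> zeros T" and "1 \<le> k"
  shows "norm (ergodic_mean t lam zt k - p) \<le> norm (z0 - p) / sqrt (1 - \<sigma>\<^sup>2)"
proof -
  note L = aggregate_stepsize_pos[OF assms(2)]
  have "\<Lambda> k *\<^sub>R (ergodic_mean t lam zt k - p) = (\<Sum>i=1..k. (t i * lam i) *\<^sub>R (zt i - p))"
    by (simp only: scaleR_diff_right aggregate_scaleR_mean[OF assms(2)] sum_subtractf)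
      (simp only: aggregate_stepsize_def scaleR_sum_left)
  then have "\<Lambda> k * norm (ergodic_mean t lam zt k - p) = norm (\<Sum>i=1..k. (t i * lam i) *\<^sub>R (zt i - p))"
    using L by (metis abs_of_pos norm_scaleR)
  also have "\<dots> \<le> (\<Sum>i=1..k. t i * lam i * (norm (z0 - p) / sqrt (1 - \<sigma>\<^sup>2)))"
  proof (rule sum_norm_le)
    fix i assume "i \<in> {1..k}"
    then have "1 \<le> i" by simp
    then show "norm ((t i * lam i) *\<^sub>R (zt i - p)) \<le> t i * lam i * (norm (z0 - p) / sqrt (1 - \<sigma>\<^sup>2))"
      using zt_near_zero[OF assms(1) \<open>1 \<le> i\<close>] t_pos[OF \<open>1 \<le> i\<close>] lam_pos[OF \<open>1 \<le> i\<close>]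
      by (simp only: norm_scaleR abs_of_pos mult_pos_pos) (intro mult_left_mono, auto)
  qed
  also have "\<dots> = \<Lambda> k * (norm (z0 - p) / sqrt (1 - \<sigma>\<^sup>2))"
    by (simp only: aggregate_stepsize_def sum_distrib_right)
  finally show ?thesis
    using L by (simp only: mult_le_cancel_left_pos)
qed

text \<open>At the point \<open>m = zt\<^sub>k\<^sup>a\<close> the summed decrease gives \<open>2 \<Lambda> \<epsilon>\<^sup>a \<le> \<parallel>z\<^sub>0 - m\<parallel>\<^sup>2 - \<parallel>z\<^sub>k - m\<parallel>\<^sup>2\<close>. With
  \<open>d = \<parallel>z\<^sub>0 - p\<parallel>\<close>, \<open>b = \<parallel>z\<^sub>k - p\<parallel> \<le> d\<close> and \<open>\<parallel>m - p\<parallel> \<le> R = d / sqrt (1 - \<sigma>\<^sup>2)\<close>, the right-hand side is at most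
  \<open>d\<^sup>2 - b\<^sup>2 + 2 (d + b) R\<close>, which increases with \<open>b\<close> up to \<open>R \<ge> d\<close> and thus is at most \<open>4 d R\<close>.\<close>

lemma aggregate_mult_error_le:
  assumes "p \<in> zeros T" and "1 \<le> k"
  shows "\<Lambda> k * ergodic_error t lam zt v \<epsilon> k \<le> 2 / sqrt (1 - \<sigma>\<^sup>2) * (norm (z0 - p))\<^sup>2"
proof -
  define m where "m = ergodic_mean t lam zt k"
  define d where "d = norm (z0 - p)"
  define b where "b = norm (z k - p)"
  define R where "R = d / sqrt (1 - \<sigma>\<^sup>2)"
  have "0 \<le> (1 - \<sigma>\<^sup>2) * (\<Sum>i=1..k. t i * (r i)\<^sup>2)"
    using one_minus_sigma2_pos t_pos
    by (intro mult_nonneg_nonneg sum_nonneg) (auto intro: less_imp_le)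
  moreover have "(\<Sum>i=1..k. t i * lam i * (\<epsilon> i + inner (zt i - m) (v i)))
      = \<Lambda> k * ergodic_error t lam zt v \<epsilon> k"
    using ergodic_covariance_shift[OF assms(2), of m 0] by (simp add: m_def)
  ultimately have "2 * (\<Lambda> k * ergodic_error t lam zt v \<epsilon> k)
      \<le> (norm (z0 - m))\<^sup>2 - (norm (z k - m))\<^sup>2"
    using telescoped_decrease[of k m] by simp
  also have "\<dots> = d\<^sup>2 - b\<^sup>2 + 2 * inner (z k - z0) (m - p)"
    unfolding d_def b_def power2_norm_eq_inner
    by (simp add: inner_diff_left inner_diff_right inner_commute algebra_simps)
  also have "\<dots> \<le> d\<^sup>2 - b\<^sup>2 + 2 * ((d + b) * R)"
  proof -
    have "inner (z k - z0) (m - p) \<le> norm (z k - z0) * norm (m - p)"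
      by (rule norm_cauchy_schwarz)
    also have "\<dots> \<le> (d + b) * R"
    proof (rule mult_mono)
      show "norm (z k - z0) \<le> d + b"
        using norm_triangle_ineq4[of "z k - p" "z0 - p"] by (simp add: d_def b_def)
      show "norm (m - p) \<le> R"
        using mean_zt_near_zero[OF assms] by (simp add: m_def d_def R_def)
    qed (auto simp: d_def b_def)
    finally show ?thesis
      by simp
  qed
  also have "\<dots> \<le> 4 * (d * R)"
  proof -
    have "b \<le> d"
      using fejer[OF assms(1)] by (simp add: b_def d_def)
    moreover have "d \<le> R"
    proof -
      have "d * sqrt (1 - \<sigma>\<^sup>2) \<le> d * 1"
        by (intro mult_left_mono) (auto simp: d_def)
      then show ?thesis
        using one_minus_sigma2_pos by (simp add: R_def pos_le_divide_eq)
    qed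
    ultimately have "0 \<le> (d - b) * (2 * R - d - b)"
      by (intro mult_nonneg_nonneg) auto
    then show ?thesis
      by (simp add: power2_eq_square algebra_simps)
  qed
  finally show ?thesis
    by (simp add: R_def d_def power2_eq_square)
qed

section \<open>Large steps\<close>

lemma exists_small_residual:
  assumes "0 < \<tau>" and large: "\<And>k. 1 \<le> k \<Longrightarrow> \<tau> \<le> t k" and "1 \<le> k"
    and total: "(1 - \<sigma>\<^sup>2) * (\<Sum>i=1..k. t i * (r i)\<^sup>2) \<le> D"
  shows "\<exists>i. 1 \<le> i \<and> i \<le> k \<and> (1 - \<sigma>\<^sup>2) * real k * \<tau> * (r i)\<^sup>2 \<le> D"
proof -
  obtain i where i: "i \<in> {1..k}" and least: "\<And>j. j \<in> {1..k} \<Longrightarrow> r i \<le> r j"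
    using ex_min_if_finite[of "r ` {1..k}"] \<open>1 \<le> k\<close>
    by (smt (verit) arg_min_if_finite(1) arg_min_least atLeastatMost_empty_iff2 finite_atLeastAtMost)
  have "(1 - \<sigma>\<^sup>2) * real k * \<tau> * (r i)\<^sup>2 = (1 - \<sigma>\<^sup>2) * (\<Sum>j=1..k. \<tau> * (r i)\<^sup>2)"
    by simp
  also have "\<dots> \<le> (1 - \<sigma>\<^sup>2) * (\<Sum>j=1..k. t j * (r j)\<^sup>2)"
    using one_minus_sigma2_pos large least \<open>0 < \<tau>\<close> t_pos
    by (intro mult_left_mono sum_mono mult_mono power_mono) (auto intro: less_imp_le)
  finally show ?thesis
    using i total by auto
qed

text \<open>As \<open>\<lambda>\<^sub>i \<ge> \<eta> / r\<^sub>i\<close>, small total residual forces large stepsizes: the power-mean inequality is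
  applied with the weights \<open>t\<^sub>i\<close>, whose sum is at least \<open>\<tau> k\<close>.\<close>

lemma aggregate_stepsize_ge:
  assumes "0 < \<eta>" and "0 < \<tau>" and "1 \<le> k"
    and step: "\<And>k. 1 \<le> k \<Longrightarrow> \<eta> \<le> lam k * r k" and relax: "\<And>k. 1 \<le> k \<Longrightarrow> \<tau> \<le> t k"
    and "0 < d" and total: "(1 - \<sigma>\<^sup>2) * (\<Sum>i=1..k. t i * (r i)\<^sup>2) \<le> d\<^sup>2"
  shows "\<eta> * ((\<tau> * real k) powr (3 / 2) * sqrt (1 - \<sigma>\<^sup>2) / d) \<le> \<Lambda> k"
proof -
  have r_pos: "0 < r i" if "1 \<le> i" for i
    using step[OF that] lam_pos[OF that] \<open>0 < \<eta>\<close> by (smt (verit) mult_nonneg_nonpos norm_ge_zero)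
  have "(\<tau> * real k) powr (3 / 2) * sqrt (1 - \<sigma>\<^sup>2) / d
      = sqrt (\<tau> * real k) ^ 3 / sqrt (d\<^sup>2 / (1 - \<sigma>\<^sup>2))"
    using assms(2,3,6) by (simp add: sqrt_cubed_eq_powr real_sqrt_divide)
  also have "\<dots> \<le> (\<Sum>i=1..k. t i / r i)"
  proof (rule sum_inverse_ge_power_mean)
    show "\<tau> * real k \<le> (\<Sum>i=1..k. t i)"
      using sum_mono[of "{1..k}" "\<lambda>_. \<tau>" t] relax by (simp add: mult.commute)
    show "(\<Sum>i=1..k. t i * (r i)\<^sup>2) \<le> d\<^sup>2 / (1 - \<sigma>\<^sup>2)"
      using total one_minus_sigma2_pos by (simp add: pos_le_divide_eq mult.commute)
  qed (use assms r_pos t_pos one_minus_sigma2_pos in \<open>auto intro: less_imp_le\<close>)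
  finally have "\<eta> * ((\<tau> * real k) powr (3 / 2) * sqrt (1 - \<sigma>\<^sup>2) / d) \<le> \<eta> * (\<Sum>i=1..k. t i / r i)"
    using \<open>0 < \<eta>\<close> by (intro mult_left_mono) auto
  also have "\<dots> = (\<Sum>i=1..k. t i * (\<eta> / r i))"
    by (simp add: sum_distrib_left mult.commute)
  also have "\<dots> \<le> (\<Sum>i=1..k. t i * lam i)"
    using step r_pos t_pos
    by (intro sum_mono mult_left_mono) (auto simp: pos_divide_le_eq intro: less_imp_le)
  finally show ?thesis
    by (simp add: aggregate_stepsize_def)
qed

end

theorem theorem2p4:
  fixes T :: "'a::{real_inner, complete_space} operator"
    and \<sigma> \<eta> \<tau> d0 :: real
    and z0 :: 'a
    and z zt v :: "nat \<Rightarrow> 'a"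
    and \<epsilon> lam t :: "nat \<Rightarrow> real"
  assumes "maximal_monotone T"
    and "zeros T \<noteq> {}"
    and "0 < \<sigma>" and "\<sigma> < 1"
    and "relaxed_HPE T \<sigma> z0 z zt v \<epsilon> lam t"
    and "d0 = infdist z0 (zeros T)"
    and "0 < \<eta>" and "0 < \<tau>"
    and "\<And>k. 1 \<le> k \<Longrightarrow> \<eta> \<le> lam k * norm (zt k - z (k - 1))"
    and "\<And>k. 1 \<le> k \<Longrightarrow> \<tau> \<le> t k"
  shows "\<forall>k\<ge>1.
     (\<exists>i. 1 \<le> i \<and> i \<le> k \<and>
        norm (v i) \<le> d0\<^sup>2 / (\<eta> * (1 - \<sigma>) * real k * \<tau>) \<and>
        \<epsilon> i \<le> \<sigma>\<^sup>2 / (2 * \<eta>) * (d0 ^ 3 / ((1 - \<sigma>\<^sup>2) * real k * \<tau>) powr (3 / 2))) \<and>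
     ergodic_mean t lam v k
       \<in> enlargement T (ergodic_error t lam zt v \<epsilon> k) (ergodic_mean t lam zt k) \<and>
     norm (ergodic_mean t lam v k)
       \<le> 2 * d0\<^sup>2 / ((\<tau> * real k) powr (3 / 2) * \<eta> * sqrt (1 - \<sigma>\<^sup>2)) \<and>
     ergodic_error t lam zt v \<epsilon> k
       \<le> 2 * d0 ^ 3 / ((\<tau> * real k) powr (3 / 2) * \<eta> * (1 - \<sigma>\<^sup>2))"
proof (intro allI impI)
  fix k :: nat
  assume "1 \<le> k"
  interpret relaxed_HPE_run T \<sigma> z0 z zt v \<epsilon> lam t
    using assms by unfold_locales
  note step = assms(9) and relax = assms(10)
  define q where "q = sqrt (1 - \<sigma>\<^sup>2)"
  define P where "P = (\<tau> * real k) powr (3 / 2)"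
  have "0 < q" and q2: "q\<^sup>2 = 1 - \<sigma>\<^sup>2"
    using one_minus_sigma2_pos by (auto simp: q_def)
  have "0 < P"
    using \<open>0 < \<tau>\<close> \<open>1 \<le> k\<close> by (simp add: P_def)
  have total: "(1 - \<sigma>\<^sup>2) * (\<Sum>i=1..k. t i * (r i)\<^sup>2) \<le> d0\<^sup>2"
    using le_infdist_square[OF assms(2), of 1] sum_residuals_le assms(6) by (simp add: dist_norm)
  obtain i where i: "1 \<le> i" "i \<le> k" and small: "(1 - \<sigma>\<^sup>2) * real k * \<tau> * (r i)\<^sup>2 \<le> d0\<^sup>2"
    using exists_small_residual[OF \<open>0 < \<tau>\<close> relax \<open>1 \<le> k\<close> total] by auto
  define M where "M = (1 - \<sigma>\<^sup>2) * real k * \<tau>"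
  have "0 < M"
    using one_minus_sigma2_pos \<open>0 < \<tau>\<close> \<open>1 \<le> k\<close> by (simp add: M_def)
  have "0 < r i"
    using step[OF i(1)] lam_pos[OF i(1)] \<open>0 < \<eta>\<close> by (smt (verit) mult_nonneg_nonpos norm_ge_zero)
  then have "0 < M * (r i)\<^sup>2"
    using \<open>0 < M\<close> by simp
  then have "d0 \<noteq> 0"
    using small by (auto simp: M_def)
  then have "0 < d0"
    using assms(6) infdist_nonneg[of z0 "zeros T"] by simp

  have "norm (v i) \<le> (1 + \<sigma>) * (r i)\<^sup>2 / \<eta>"
    by (rule norm_v_le_residual[OF i(1) \<open>0 < \<eta>\<close> step[OF i(1)]])
  also have "\<dots> \<le> (1 + \<sigma>) * (d0\<^sup>2 / M) / \<eta>"
    using small \<open>0 < M\<close> \<open>0 < \<eta>\<close> \<open>0 < \<sigma>\<close>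
    by (intro divide_right_mono mult_left_mono) (auto simp: M_def pos_le_divide_eq mult_ac)
  also have "\<dots> = d0\<^sup>2 / (\<eta> * (1 - \<sigma>) * real k * \<tau>)"
  proof -
    have M: "M = (1 + \<sigma>) * ((1 - \<sigma>) * real k * \<tau>)"
      by (simp add: M_def power2_eq_square algebra_simps)
    have "1 + \<sigma> \<noteq> 0"
      using \<open>0 < \<sigma>\<close> by simp
    then show ?thesis
      unfolding M by (simp add: mult_ac)
  qed
  finally have v_bound: "norm (v i) \<le> d0\<^sup>2 / (\<eta> * (1 - \<sigma>) * real k * \<tau>)" .

  have "(r i * sqrt M)\<^sup>2 \<le> d0\<^sup>2"
    using small \<open>0 < M\<close> by (simp add: M_def power_mult_distrib mult_ac)
  then have "r i * sqrt M \<le> d0"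
    using \<open>0 < d0\<close> by (rule power2_le_imp_le[OF _ less_imp_le])
  then have "r i \<le> d0 / sqrt M"
    using \<open>0 < M\<close> by (simp add: pos_le_divide_eq)
  then have "r i ^ 3 \<le> (d0 / sqrt M) ^ 3"
    by (rule power_mono) simp
  also have "\<dots> = d0 ^ 3 / M powr (3 / 2)"
    using \<open>0 < M\<close> by (simp add: power_divide sqrt_cubed_eq_powr)
  finally have "\<sigma>\<^sup>2 / (2 * \<eta>) * r i ^ 3 \<le> \<sigma>\<^sup>2 / (2 * \<eta>) * (d0 ^ 3 / M powr (3 / 2))"
    using \<open>0 < \<eta>\<close> by (intro mult_left_mono) auto
  then have eps_bound: "\<epsilon> i \<le> \<sigma>\<^sup>2 / (2 * \<eta>) * (d0 ^ 3 / M powr (3 / 2))"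
    using eps_le_residual[OF i(1) \<open>0 < \<eta>\<close> step[OF i(1)]] by simp

  have "0 < \<eta> * (P * q / d0)"
    using \<open>0 < \<eta>\<close> \<open>0 < P\<close> \<open>0 < q\<close> \<open>0 < d0\<close> by simp
  moreover have "\<eta> * (P * q / d0) \<le> \<Lambda> k"
    using aggregate_stepsize_ge[OF \<open>0 < \<eta>\<close> \<open>0 < \<tau>\<close> \<open>1 \<le> k\<close> step relax \<open>0 < d0\<close> total]
    by (simp add: P_def q_def)
  \<comment> \<open>A bound \<open>\<Lambda> x \<le> c\<close> with \<open>c \<ge> 0\<close> becomes a bound on \<open>x\<close> of either sign.\<close>
  ultimately have divide: "x \<le> c / (\<eta> * (P * q / d0))" if "\<Lambda> k * x \<le> c" "0 \<le> c" for x c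
  proof -
    have "x \<le> c / \<Lambda> k"
      using that(1) aggregate_stepsize_pos[OF \<open>1 \<le> k\<close>] by (simp add: pos_le_divide_eq mult.commute)
    also have "\<dots> \<le> c / (\<eta> * (P * q / d0))"
      using that(2) \<open>0 < \<eta> * (P * q / d0)\<close> \<open>\<eta> * (P * q / d0) \<le> \<Lambda> k\<close>
        aggregate_stepsize_pos[OF \<open>1 \<le> k\<close>]
      by (intro divide_left_mono) (simp_all only: mult_pos_pos)
    finally show ?thesis .
  qed

  have "\<Lambda> k * norm (ergodic_mean t lam v k) / 2 \<le> infdist z0 (zeros T)"
    unfolding infdist_notempty[OF assms(2)]
    using aggregate_mult_norm_mean_v_le[OF _ \<open>1 \<le> k\<close>]
    by (intro cINF_greatest[OF assms(2)]) (simp add: dist_norm field_simps)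
  then have "\<Lambda> k * norm (ergodic_mean t lam v k) \<le> 2 * d0"
    using assms(6) by simp
  from divide[OF this] have mean_bound: "norm (ergodic_mean t lam v k) \<le> 2 * d0\<^sup>2 / (P * \<eta> * q)"
    using \<open>0 < d0\<close> by (simp add: power2_eq_square mult_ac)

  have "\<Lambda> k * ergodic_error t lam zt v \<epsilon> k \<le> 2 / q * d0\<^sup>2"
    unfolding assms(6)
    by (rule le_infdist_square[OF assms(2)])
      (use aggregate_mult_error_le[OF _ \<open>1 \<le> k\<close>] \<open>0 < q\<close> in \<open>auto simp: dist_norm q_def\<close>)
  from divide[OF this] have "ergodic_error t lam zt v \<epsilon> k \<le> 2 * d0 ^ 3 / (P * \<eta> * q\<^sup>2)"
    using \<open>0 < d0\<close> \<open>0 < q\<close> by (simp add: power2_eq_square power3_eq_cube mult_ac)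
  then show "(\<exists>i. 1 \<le> i \<and> i \<le> k \<and>
        norm (v i) \<le> d0\<^sup>2 / (\<eta> * (1 - \<sigma>) * real k * \<tau>) \<and>
        \<epsilon> i \<le> \<sigma>\<^sup>2 / (2 * \<eta>) * (d0 ^ 3 / ((1 - \<sigma>\<^sup>2) * real k * \<tau>) powr (3 / 2))) \<and>
     ergodic_mean t lam v k
       \<in> enlargement T (ergodic_error t lam zt v \<epsilon> k) (ergodic_mean t lam zt k) \<and>
     norm (ergodic_mean t lam v k)
       \<le> 2 * d0\<^sup>2 / ((\<tau> * real k) powr (3 / 2) * \<eta> * sqrt (1 - \<sigma>\<^sup>2)) \<and>
     ergodic_error t lam zt v \<epsilon> k
       \<le> 2 * d0 ^ 3 / ((\<tau> * real k) powr (3 / 2) * \<eta> * (1 - \<sigma>\<^sup>2))"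
    using i v_bound eps_bound[unfolded M_def] ergodic_mean_in_enlargement[OF \<open>1 \<le> k\<close>]
      mean_bound[unfolded P_def q_def] unfolding q2 P_def by blast
qed

end
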